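(* Let $k,n$ be positive integers, and put $a=2k$ and $b=an+2$. For positive integers $t$, let $C^{(+)}_{t,n}$ denote the number of $(t,\,tn+1)$-Dyck paths; since $\gcd(t,tn+1)=1$, this equals $\frac{1}{t(n+1)+1}\binom{t(n+1)+1}{t}$. Then the number $|\mathscr{D}_{a,b}|$ of $(a,b)$-Dyck paths satisfies \[ |\mathscr{D}_{a,b}| = C^{(+)}_{a,n}+\sum_{j=1}^{k} C^{(+)}_{a-j,n}\,C^{(+)}_{j,n}. \]
   Context: For positive integers $a,b$, an $(a,b)$-Dyck path is a lattice path from $(0,a)$ to $(b,0)$ using unit steps $(1,0)$ (east) and $(0,-1)$ (south) which never goes strictly above the line segment joining $(0,a)$ to $(b,0)$ (touching the segment is allowed). Equivalently, it is determined by the sequence $(\lambda_{a-1},\dots,\lambda_1)$ of nonnegative integers, weakly increasing from $\lambda_{a-1}$ to $\lambda_1$, with $\lambda_{a-l}\le \lfloor bl/a\rfloor$ for $1\le l\le a-1$ (the numbers of unit boxes to the left of the path in the rows of the $a\times b$ rectangle). $\mathscr{D}_{a,b}$ denotes the set of $(a,b)$-Dyck paths. It is standard that when $\gcd(a,b)=1$, $|\mathscr{D}_{a,b}|=\frac{1}{a+b}\binom{a+b}{a}$. *)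

theory Defs
  imports Complex_Main
begin

datatype step = East | South

fun move :: "step \<Rightarrow> int \<times> int \<Rightarrow> int \<times> int" where
  "move East (x, y) = (x + 1, y)"
| "move South (x, y) = (x, y - 1)"

definition vertex :: "int \<times> int \<Rightarrow> step list \<Rightarrow> nat \<Rightarrow> int \<times> int" where
  "vertex P p i = fold move (take i p) P"

(* The line through (0,a) and (b,0) is a x + b y = a b. The closed half-plane below it is
   convex, so a path stays in it as soon as all its vertices do. *)
definition dyck_path :: "nat \<Rightarrow> nat \<Rightarrow> step list \<Rightarrow> bool" where
  "dyck_path a b p \<longleftrightarrow>
     vertex (0, int a) p (length p) = (int b, 0) \<and>
     (\<forall>i\<le>length p. case vertex (0, int a) p i of (x, y) \<Rightarrow>
        int a * x + int b * y \<le> int a * int b)"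

definition dyck_paths :: "nat \<Rightarrow> nat \<Rightarrow> step list set" where
  "dyck_paths a b = {p. dyck_path a b p}"

definition C_plus :: "nat \<Rightarrow> nat \<Rightarrow> nat" where
  "C_plus t n = card (dyck_paths t (t * n + 1))"

end

(* Paths are counted from the end: if e East and r South steps remain, the half-plane condition
   for (t, t n + 1) reads "r = 0 or e > n r".  Reversal turns this into a ballot problem whose
   counts are differences of binomial coefficients, which gives the Fuss-Catalan number.
   For (a, b) = (2 k, a n + 2) the condition is e > n r for 0 < r <= k and e > n r + 1 for
   k < r <= a.  Either e > n r + 1 as long as r > 0, or there is a first East step into the line
   e = n r + 1; if it occurs at r = j <= k, the path splits into pieces counted by
   C_plus (a - j) n and C_plus j n. *)

theory Submission
  imports Defs
begin

section \<open>Recursive enumeration of lattice paths inside a region\<close>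

text \<open>The starting point and the region vary freely, so that deleting the first step of a path
  leads to a set of the same kind.\<close>

definition paths_within :: "(int \<times> int \<Rightarrow> bool) \<Rightarrow> int \<times> int \<Rightarrow> int \<times> int \<Rightarrow> step list set" where
  "paths_within H Q P =
     {p. vertex P p (length p) = Q \<and> (\<forall>i\<le>length p. H (vertex P p i))}"

lemma Nil_in_paths_within: "[] \<in> paths_within H Q P \<longleftrightarrow> P = Q \<and> H P"
  by (auto simp: paths_within_def vertex_def)

lemma all_le_Suc_iff: "(\<forall>i\<le>Suc m. R i) \<longleftrightarrow> R 0 \<and> (\<forall>i\<le>m. R (Suc i))"
  using All_less_Suc2[of "Suc m" R] by (simp add: less_Suc_eq_le)

lemma Cons_in_paths_within:
  "s # p \<in> paths_within H Q P \<longleftrightarrow> H P \<and> p \<in> paths_within H Q (move s P)"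
  by (auto simp: paths_within_def vertex_def all_le_Suc_iff)

lemma paths_within_rec:
  "paths_within H Q P =
     (if H P then (if P = Q then {[]} else {})
        \<union> (Cons East ` paths_within H Q (move East P)
        \<union> Cons South ` paths_within H Q (move South P)) else {})"
  (is "?A = ?B")
proof (rule set_eqI)
  fix p show "p \<in> ?A \<longleftrightarrow> p \<in> ?B"
  proof (cases p)
    case Nil
    then show ?thesis by (auto simp: Nil_in_paths_within)
  next
    case (Cons s q)
    then show ?thesis by (cases s) (auto simp: Cons_in_paths_within)
  qed
qed

lemma fold_move_mono:
  "fst P \<le> fst (fold move p P) \<and> snd (fold move p P) \<le> snd P"
proof (induction p arbitrary: P)
  case (Cons s p)
  show ?case using Cons[of "move s P"] by (cases s; cases P) auto
qed simp

text \<open>East steps never decrease \<open>x\<close> and South steps never increase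
  \<open>y\<close>. This removes the branches of the recursion that overshoot the endpoint.\<close>

lemma paths_within_empty:
  assumes "fst Q < fst P \<or> snd P < snd Q"
  shows "paths_within H Q P = {}"
proof -
  have "fold move p P \<noteq> Q" for p
    using fold_move_mono[of P p] assms by auto
  then show ?thesis by (auto simp: paths_within_def vertex_def)
qed

text \<open>\<open>e\<close> East and \<open>r\<close> South steps are still to come, and
  \<open>L\<close> tells which pairs \<open>(e, r)\<close> are allowed, both ends of the path
  included.\<close>

fun suffix_count :: "(nat \<Rightarrow> nat \<Rightarrow> bool) \<Rightarrow> nat \<Rightarrow> nat \<Rightarrow> nat" where
  "suffix_count L 0 0 = (if L 0 0 then 1 else 0)"
| "suffix_count L (Suc e) 0 = (if L (Suc e) 0 then suffix_count L e 0 else 0)"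
| "suffix_count L 0 (Suc r) = (if L 0 (Suc r) then suffix_count L 0 r else 0)"
| "suffix_count L (Suc e) (Suc r) =
     (if L (Suc e) (Suc r) then suffix_count L e (Suc r) + suffix_count L (Suc e) r else 0)"

text \<open>The recursion never raises \<open>r\<close>. The bound matters because the half-plane
  conditions simplify only for bounded \<open>r\<close>.\<close>

lemma suffix_count_cong:
  assumes "\<And>e' r'. r' \<le> r \<Longrightarrow> L e' r' \<longleftrightarrow> L' e' r'"
  shows "suffix_count L e r = suffix_count L' e r"
  using assms by (induction L e r rule: suffix_count.induct) auto

lemma card_paths_within:
  fixes b e r :: nat
  assumes "\<And>e r :: nat. H (int b - int e, int r) \<longleftrightarrow> L e r"
  shows "finite (paths_within H (int b, 0) (int b - int e, int r)) \<and>
    card (paths_within H (int b, 0) (int b - int e, int r)) = suffix_count L e r"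
  using assms
proof (induction L e r rule: suffix_count.induct)
  case (1 L)
  have H: "H (int b, 0) \<longleftrightarrow> L 0 0" using 1(1)[of 0 0] by simp
  show ?case
    by (subst (1 2) paths_within_rec) (simp add: H paths_within_empty)
next
  case (2 L e)
  have H: "H (int b - int (Suc e), 0) \<longleftrightarrow> L (Suc e) 0" using 2(2)[of "Suc e" 0] by simp
  have m: "move East (int b - int (Suc e), 0) = (int b - int e, 0)" by simp
  show ?case
  proof (cases "L (Suc e) 0")
    case True
    have IH: "finite (paths_within H (int b, 0) (int b - int e, 0))"
      "card (paths_within H (int b, 0) (int b - int e, 0)) = suffix_count L e 0"
      using 2 True by auto
    show ?thesis
      by (subst (1 2) paths_within_rec)
        (use True H IH in \<open>simp add: m paths_within_empty card_image del: of_nat_Suc move.simps(1)\<close>)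
  next
    case False
    then show ?thesis
      by (subst (1 2) paths_within_rec) (use H in \<open>simp del: of_nat_Suc\<close>)
  qed
next
  case (3 L r)
  have H: "H (int b, int (Suc r)) \<longleftrightarrow> L 0 (Suc r)" using 3(2)[of 0 "Suc r"] by simp
  have m: "move South (int b, int (Suc r)) = (int b, int r)" by simp
  show ?case
  proof (cases "L 0 (Suc r)")
    case True
    have IH: "finite (paths_within H (int b, 0) (int b, int r))"
      "card (paths_within H (int b, 0) (int b, int r)) = suffix_count L 0 r"
      using 3 True by auto
    show ?thesis
      by (subst (1 2) paths_within_rec)
        (use True H IH in \<open>simp add: m paths_within_empty card_image del: of_nat_Suc move.simps(2)\<close>)
  next
    case False
    then show ?thesis
      by (subst (1 2) paths_within_rec) (use H in \<open>simp del: of_nat_Suc\<close>)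
  qed
next
  case (4 L e r)
  let ?P = "(int b - int (Suc e), int (Suc r))"
  have H: "H ?P \<longleftrightarrow> L (Suc e) (Suc r)" using 4(3)[of "Suc e" "Suc r"] by simp
  have m: "move East ?P = (int b - int e, int (Suc r))"
    "move South ?P = (int b - int (Suc e), int r)" by simp_all
  show ?case
  proof (cases "L (Suc e) (Suc r)")
    case True
    let ?E = "paths_within H (int b, 0) (int b - int e, int (Suc r))"
    let ?S = "paths_within H (int b, 0) (int b - int (Suc e), int r)"
    have IH: "finite ?E" "card ?E = suffix_count L e (Suc r)"
      "finite ?S" "card ?S = suffix_count L (Suc e) r"
      using 4 True by auto
    have eq: "paths_within H (int b, 0) ?P = Cons East ` ?E \<union> Cons South ` ?S"
      by (subst paths_within_rec)
        (use True H in \<open>simp add: m del: of_nat_Suc move.simps\<close>)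
    have "card (Cons East ` ?E \<union> Cons South ` ?S) = card ?E + card ?S"
      using IH by (subst card_Un_disjoint) (auto simp: card_image)
    then show ?thesis
      unfolding eq using IH True by simp
  next
    case False
    then show ?thesis
      by (subst (1 2) paths_within_rec) (use H in \<open>simp del: of_nat_Suc\<close>)
  qed
qed

lemma card_dyck_paths:
  "card (dyck_paths a b) = suffix_count (\<lambda>e r. b * r \<le> a * e) b a"
proof -
  let ?H = "\<lambda>(x, y). int a * x + int b * y \<le> int a * int b"
  have "dyck_paths a b = paths_within ?H (int b, 0) (int b - int b, int a)"
    by (simp add: dyck_paths_def dyck_path_def paths_within_def)
  \<comment> \<open>Cancelling \<open>a * b\<close> in
    \<open>a * (b - e) + b * r \<le> a * b\<close> leaves a condition on the remaining steps
    alone.\<close>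
  moreover have "?H (int b - int e, int r) \<longleftrightarrow> b * r \<le> a * e" for e r
  proof -
    have "?H (int b - int e, int r) \<longleftrightarrow> int (b * r) \<le> int (a * e)"
      by (simp add: algebra_simps)
    then show ?thesis by (simp only: of_nat_le_iff)
  qed
  ultimately show ?thesis
    using card_paths_within[of ?H b "\<lambda>e r. b * r \<le> a * e" b a] by simp
qed

section \<open>Ballot numbers for a line of integer slope\<close>

text \<open>The second argument is the surplus \<open>d = e - n * r\<close> over the boundary line.\<close>

definition ballot :: "nat \<Rightarrow> nat \<Rightarrow> nat \<Rightarrow> nat" where
  "ballot n d r = suffix_count (\<lambda>e r. 0 < r \<longrightarrow> n * r < e) (n * r + d) r"

lemma ballot_0_right [simp]: "ballot n d 0 = 1"
  by (induction d) (simp_all add: ballot_def)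

lemma suffix_count_not_admissible: "\<not> L e r \<Longrightarrow> suffix_count L e r = 0"
  by (cases e; cases r) auto

lemma ballot_0_left [simp]: "ballot n 0 (Suc r) = 0"
  by (simp add: ballot_def suffix_count_not_admissible)

text \<open>An East step lowers the surplus by 1, a South step raises it by
  \<open>n\<close>.\<close>

lemma ballot_Suc_Suc:
  "ballot n (Suc d) (Suc r) = ballot n d (Suc r) + ballot n (Suc d + n) r"
proof -
  have eqs: "n * Suc r + Suc d = Suc (n * Suc r + d)"
    "Suc (n * Suc r + d) = n * r + (Suc d + n)"
    by simp_all
  have "suffix_count (\<lambda>e r. 0 < r \<longrightarrow> n * r < e) (Suc (n * Suc r + d)) (Suc r) =
    suffix_count (\<lambda>e r. 0 < r \<longrightarrow> n * r < e) (n * Suc r + d) (Suc r) +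
    suffix_count (\<lambda>e r. 0 < r \<longrightarrow> n * r < e) (Suc (n * Suc r + d)) r"
    by (simp only: suffix_count.simps) simp
  then show ?thesis unfolding ballot_def eqs(1) by (simp only: eqs(2))
qed

lemma real_binomial_Suc_mult:
  assumes "r \<le> N"
  shows "real (Suc r) * real (N choose Suc r) = (real N - real r) * real (N choose r)"
proof -
  have "Suc r * (N choose Suc r) = (N - r) * (N choose r)"
    using binomial_absorb_comp[of N r] binomial_absorption[of r N] by simp
  then have "real (Suc r * (N choose Suc r)) = real ((N - r) * (N choose r))" by simp
  with assms show ?thesis by (simp only: of_nat_mult of_nat_diff)
qed

text \<open>Both sides vanish for \<open>d = 0\<close> and satisfy the recurrence
  \<open>ballot_Suc_Suc\<close>, on the right by Pascal's rule.\<close>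

lemma ballot_closed_form:
  "real (ballot n d (Suc r)) =
     real ((n * Suc r + d + r) choose Suc r) - real n * real ((n * Suc r + d + r) choose r)"
proof (induction r arbitrary: d)
  case 0
  show ?case by (induction d) (simp_all add: ballot_Suc_Suc)
next
  case outer: (Suc r)
  show ?case
  proof (induction d)
    case 0
    let ?N = "n * Suc (Suc r) + 0 + Suc r"
    \<comment> \<open>Here \<open>?N - Suc r = n * Suc (Suc r)\<close>, so the two binomial terms
      cancel.\<close>
    have "real (Suc (Suc r)) * real (?N choose Suc (Suc r)) =
        (real ?N - real (Suc r)) * real (?N choose Suc r)"
      by (rule real_binomial_Suc_mult) simp
    also have "\<dots> = real (Suc (Suc r)) * (real n * real (?N choose Suc r))"
      by (simp add: algebra_simps)
    finally have "real (?N choose Suc (Suc r)) = real n * real (?N choose Suc r)"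
      by (simp only: mult_cancel_left of_nat_eq_0_iff) simp
    then show ?case by simp
  next
    case (Suc d)
    let ?N = "n * Suc (Suc r) + d + Suc r"
    \<comment> \<open>Both recursive terms get the same upper index \<open>?N\<close>, as Pascal's
      rule demands.\<close>
    have N: "n * Suc r + (Suc d + n) + r = ?N" "n * Suc (Suc r) + Suc d + Suc r = Suc ?N"
      by simp_all
    show ?case
      unfolding ballot_Suc_Suc of_nat_add Suc.IH outer.IH N
        binomial_Suc_Suc
      by (simp only: of_nat_add distrib_left)
  qed
qed

text \<open>The half-plane condition reads \<open>r \<le> t * (e - n * r)\<close> over the integers.
  For \<open>0 < r \<le> t\<close> it says that the surplus is at least 1, which is also its initial
  value.\<close>

lemma C_plus_eq_ballot:
  assumes "t > 0"
  shows "C_plus t n = ballot n 1 t"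
proof -
  have "(t * n + 1) * r \<le> t * e \<longleftrightarrow> (0 < r \<longrightarrow> n * r < e)" if "r \<le> t" for e r
  proof (cases "r = 0")
    case False
    show ?thesis
    proof (cases "n * r < e")
      case True
      then have "t * (n * r + 1) \<le> t * e" by (intro mult_le_mono) auto
      then show ?thesis using True that by (simp add: algebra_simps)
    next
      case le: False
      then have "t * e \<le> t * (n * r)" by simp
      also have "\<dots> < (t * n + 1) * r" using False by (simp add: algebra_simps)
      finally show ?thesis using le False by simp
    qed
  qed simp
  then show ?thesis
    unfolding C_plus_def card_dyck_paths ballot_def
    by (subst mult.commute[of n t]) (rule suffix_count_cong)
qed

lemma C_plus_formula:
  assumes "t > 0"
  shows "real (C_plus t n) = 1 / real (t * (n + 1) + 1) * real ((t * (n + 1) + 1) choose t)"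
proof -
  obtain r where t: "t = Suc r" using assms gr0_implies_Suc by blast
  let ?N = "n * Suc r + 1 + r"
  have N: "t * (n + 1) = ?N" by (simp add: t)
  have C: "real (C_plus t n) = real (?N choose Suc r) - real n * real (?N choose r)"
    using C_plus_eq_ballot[OF assms] ballot_closed_form[of n 1 r] by (simp only: t)
  have 1: "real (Suc r) * real (?N choose Suc r) = (real ?N - real r) * real (?N choose r)"
    by (rule real_binomial_Suc_mult) simp
  have 2: "real (?N + 1 choose Suc r) = real (?N choose Suc r) + real (?N choose r)"
    by simp
  define x y where "x = real (?N choose Suc r)" and "y = real (?N choose r)"
  define u v where "u = real n" and "v = real r"
  have rN: "real ?N = u * (v + 1) + 1 + v" by (simp add: u_def v_def algebra_simps)
  have "(v + 1) * x = (u * (v + 1) + 1) * y"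
    using 1 unfolding rN x_def[symmetric] y_def[symmetric] by (simp add: v_def add.commute)
  \<comment> \<open>With \<open>A = u * (v + 1) + 1\<close>, the relation
    \<open>(v + 1) * x = A * y\<close> also gives \<open>u * A * y = (A - 1) * x\<close>; expanding
    the left side leaves \<open>x + y\<close>.\<close>
  then have "(u * (v + 1) + 1 + v + 1) * (x - u * y) = x + y"
    by algebra
  then have eq: "real (?N + 1) * real (C_plus t n) = real (?N + 1 choose Suc r)"
    unfolding C 2 x_def[symmetric] y_def[symmetric] u_def[symmetric]
    using rN by (simp only: of_nat_add of_nat_1)
  have div: "c = 1 / m * z" if "m * c = z" "m \<noteq> 0" for c m z :: real
    using that by auto
  have "real (C_plus t n) = 1 / real (?N + 1) * real (?N + 1 choose Suc r)"
    by (rule div[OF eq]) (simp only: of_nat_eq_0_iff add_is_0 one_neq_zero simp_thms)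
  then show ?thesis unfolding N by (simp only: t)
qed

section \<open>First arrival at surplus 1 in the doubled rectangle\<close>

text \<open>Summand \<open>j\<close> counts the paths that first reach surplus 1 with
  \<open>j\<close> South steps left; before that, the surplus minus 1 behaves like a ballot path.
  Instead of a bijection, the proof takes arbitrary \<open>r\<close> and \<open>d\<close> and checks
  that both sides obey one recurrence.\<close>

lemma suffix_count_doubled:
  fixes k n :: nat
  assumes "r \<le> 2 * k"
  defines "L \<equiv> \<lambda>e r. (2 * k * n + 2) * r \<le> 2 * k * e"
  shows "suffix_count L (n * r + d + 1) r =
    ballot n d r + (\<Sum>j=1..min k r. ballot n d (r - j) * ballot n 1 j)"
  using assms(1)
proof (induction r arbitrary: d)
  case 0
  have "suffix_count L e 0 = 1" for e
    by (induction e) (simp_all add: L_def)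
  then show ?case by (simp del: suffix_count.simps)
next
  case outer: (Suc s)
  \<comment> \<open>Halved, the condition is \<open>r \<le> k * (e - n * r)\<close>: surplus 1
    suffices for \<open>0 < r \<le> k\<close>, surplus 2 is required for
    \<open>k < r \<le> 2 * k\<close>.\<close>
  have L: "L e r \<longleftrightarrow> n * r * k + r \<le> k * e" for e r
  proof -
    have "L e r \<longleftrightarrow> 2 * (n * r * k + r) \<le> 2 * (k * e)"
      by (simp add: L_def algebra_simps)
    then show ?thesis by (simp only: mult_le_cancel1) simp
  qed
  have L_le: "L e r \<longleftrightarrow> (0 < r \<longrightarrow> n * r < e)" if "r \<le> k" for e r
  proof (cases "n * r < e")
    case True
    then have "k * (n * r + 1) \<le> k * e" by (intro mult_le_mono) auto
    then show ?thesis using True that by (simp add: L algebra_simps)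
  next
    case False
    then have "k * e \<le> n * r * k" by simp
    then have "L e r \<longleftrightarrow> r = 0" unfolding L by (cases "r = 0"; linarith?) simp
    then show ?thesis using False by simp
  qed
  show ?case
  proof (induction d)
    case 0
    show ?case
    proof (cases "Suc s \<le> k")
      case True
      \<comment> \<open>The path starts at surplus 1, so only \<open>j = Suc s\<close> contributes,
        with first factor \<open>ballot n 0 0 = 1\<close>.\<close>
      have z: "(\<Sum>j=1..s. ballot n 0 (Suc s - j) * ballot n 1 j) = 0"
        by (rule sum.neutral) (auto simp: Suc_diff_le)
      have "suffix_count L (n * Suc s + 0 + 1) (Suc s) = ballot n 1 (Suc s)"
        unfolding ballot_def add_0_right
        using L_le True by (intro suffix_count_cong) auto
      also have "\<dots> = ballot n 0 (Suc s) +
          (\<Sum>j=1..min k (Suc s). ballot n 0 (Suc s - j) * ballot n 1 j)"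
        using True z by (simp add: min_absorb2)
      finally show ?thesis .
    next
      case False
      \<comment> \<open>Surplus 1 is forbidden here, and the range of \<open>j\<close> stops short
        of \<open>Suc s\<close>: both sides are 0.\<close>
      have "\<not> L (n * Suc s + 0 + 1) (Suc s)"
        using False by (simp add: L algebra_simps)
      moreover have "(\<Sum>j=1..min k (Suc s). ballot n 0 (Suc s - j) * ballot n 1 j) = 0"
        using False by (intro sum.neutral) (auto simp: Suc_diff_le)
      ultimately show ?thesis by (simp only: suffix_count_not_admissible ballot_0_left add_0 not_False_eq_True)
    qed
  next
    case (Suc d)
    have adm: "L (n * Suc s + Suc d + 1) (Suc s)"
    proof -
      have "k * (n * Suc s + 2) \<le> k * (n * Suc s + Suc d + 1)" by (intro mult_le_mono) auto
      then show ?thesis using outer.prems by (simp add: L algebra_simps)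
    qed
    have e: "n * Suc s + Suc d + 1 = Suc (n * Suc s + d + 1)"
      "Suc (n * Suc s + d + 1) = n * s + (Suc d + n) + 1" by simp_all
    let ?f = "\<lambda>r d j. ballot n d (r - j) * ballot n 1 j"
    have "suffix_count L (n * Suc s + Suc d + 1) (Suc s) =
        suffix_count L (n * Suc s + d + 1) (Suc s) + suffix_count L (n * s + (Suc d + n) + 1) s"
      using adm unfolding e(1) suffix_count.simps by (simp only: e(2) if_True)
    also have "\<dots> = ballot n (Suc d) (Suc s) +
        ((\<Sum>j=1..min k (Suc s). ?f (Suc s) d j) + (\<Sum>j=1..min k s. ?f s (Suc d + n) j))"
      using Suc.IH outer.IH[of "Suc d + n"] outer.prems
      by (simp add: ballot_Suc_Suc)
    also have "(\<Sum>j=1..min k (Suc s). ?f (Suc s) d j) + (\<Sum>j=1..min k s. ?f s (Suc d + n) j) =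
        (\<Sum>j=1..min k (Suc s). ?f (Suc s) (Suc d) j)"
    proof -
      \<comment> \<open>The sums are padded to a common range. For \<open>j \<le> s\<close> the
        first factors add up by \<open>ballot_Suc_Suc\<close>; a term \<open>j = Suc s\<close> has
        first factor 1 for every surplus and comes from the first sum alone.\<close>
      have "(\<Sum>j=1..min k s. ?f s (Suc d + n) j) =
          (\<Sum>j=1..min k (Suc s). if j \<le> s then ?f s (Suc d + n) j else 0)"
        by (rule sum.mono_neutral_cong_left) auto
      moreover have "?f (Suc s) (Suc d) j =
          ?f (Suc s) d j + (if j \<le> s then ?f s (Suc d + n) j else 0)"
        if "j \<in> {1..min k (Suc s)}" for j
        using that by (cases "j \<le> s")
          (auto simp: Suc_diff_le ballot_Suc_Suc algebra_simps not_le dest: le_antisym)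
      ultimately show ?thesis by (simp add: sum.distrib)
    qed
    finally show ?case .
  qed
qed

theorem theorem2:
  fixes k n a b :: nat
  assumes "k > 0" and "n > 0" and "a = 2 * k" and "b = a * n + 2"
  shows "(\<forall>t>0. real (C_plus t n) =
            1 / real (t * (n + 1) + 1) * real ((t * (n + 1) + 1) choose t)) \<and>
         card (dyck_paths a b) = C_plus a n + (\<Sum>j=1..k. C_plus (a - j) n * C_plus j n)"
proof (intro conjI allI impI)
  fix t :: nat assume "t > 0"
  then show "real (C_plus t n) =
      1 / real (t * (n + 1) + 1) * real ((t * (n + 1) + 1) choose t)"
    by (rule C_plus_formula)
next
  \<comment> \<open>The initial surplus is \<open>b - n * a = 2\<close>, split as
    \<open>d + 1\<close> with \<open>d = 1\<close>.\<close>
  have b: "b = n * a + 1 + 1" "b = 2 * k * n + 2" using assms by simp_all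
  have "card (dyck_paths a b) =
      suffix_count (\<lambda>e r. (2 * k * n + 2) * r \<le> 2 * k * e) (n * a + 1 + 1) a"
    unfolding card_dyck_paths b(1)[symmetric] b(2)[symmetric] by (simp only: assms(3))
  also have "\<dots> = ballot n 1 a + (\<Sum>j=1..min k a. ballot n 1 (a - j) * ballot n 1 j)"
    using assms by (intro suffix_count_doubled) simp
  also have "min k a = k" using assms by simp
  also have "(\<Sum>j=1..k. ballot n 1 (a - j) * ballot n 1 j) =
      (\<Sum>j=1..k. C_plus (a - j) n * C_plus j n)"
    \<comment> \<open>Since \<open>a - j \<ge> k > 0\<close>, both factors are ballot numbers of
      positive height.\<close>
    using assms by (intro sum.cong) (auto simp: C_plus_eq_ballot)
  also have "ballot n 1 a = C_plus a n" using assms by (simp add: C_plus_eq_ballot)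
  finally show "card (dyck_paths a b) = C_plus a n + (\<Sum>j=1..k. C_plus (a - j) n * C_plus j n)" .
qed

end
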